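(* Let $R$ be a finite commutative local ring with identity which is not a field. Then $$\gamma^o(\Gamma(R)) \leq \left(|Z(R)^*| - \gamma^o(\Gamma(R))\right)\left( \gamma^o(\Gamma(R)) -1\right) + 1.$$
   Context: $Z(R)$ denotes the set of zero-divisors of $R$, including $0$, and $Z(R)^*=Z(R)\setminus\{0\}$. The zero-divisor graph $\Gamma(R)$ is the simple graph with vertex set $Z(R)^*$, in which distinct $u,v$ are adjacent if and only if $uv=0$. For a simple graph $\Gamma=(V,E)$, a set $S\subseteq V$ and a vertex $v$, let $\delta_S(v)$ be the number of neighbors of $v$ in $S$ and $\overline{S}=V\setminus S$. A nonempty set $S\subseteq V$ is a global offensive alliance if $\delta_S(v)\geq \delta_{\overline{S}}(v)+1$ for every $v\in\overline{S}$. $\gamma^o(\Gamma)$ is the minimum cardinality of a global offensive alliance of $\Gamma$. *)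

theory Defs
  imports "HOL-Algebra.Ideal"
begin

definition local_ring :: "('a, 'b) ring_scheme \<Rightarrow> bool" where
  "local_ring R \<longleftrightarrow> cring R \<and> (\<exists>!M. maximalideal M R)"

definition zero_divisors :: "('a, 'b) ring_scheme \<Rightarrow> 'a set" where
  "zero_divisors R =
     {x \<in> carrier R. \<exists>y \<in> carrier R. y \<noteq> \<zero>\<^bsub>R\<^esub> \<and> x \<otimes>\<^bsub>R\<^esub> y = \<zero>\<^bsub>R\<^esub>}"

definition nonzero_zero_divisors :: "('a, 'b) ring_scheme \<Rightarrow> 'a set" where
  "nonzero_zero_divisors R = zero_divisors R - {\<zero>\<^bsub>R\<^esub>}"

text \<open>A simple graph is a pair of a vertex set and a set of edges, each edge being a set of
  two distinct vertices.\<close>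

type_synonym 'a sgraph = "'a set \<times> 'a set set"

definition zero_divisor_graph :: "('a, 'b) ring_scheme \<Rightarrow> 'a sgraph" where
  "zero_divisor_graph R =
     (nonzero_zero_divisors R,
      {{u, v} | u v. u \<in> nonzero_zero_divisors R \<and> v \<in> nonzero_zero_divisors R \<and>
                     u \<noteq> v \<and> u \<otimes>\<^bsub>R\<^esub> v = \<zero>\<^bsub>R\<^esub>})"

definition nbr_count :: "'a sgraph \<Rightarrow> 'a set \<Rightarrow> 'a \<Rightarrow> nat" where
  "nbr_count G S v = card {u \<in> S. {u, v} \<in> snd G}"

definition global_offensive_alliance :: "'a sgraph \<Rightarrow> 'a set \<Rightarrow> bool" where
  "global_offensive_alliance G S \<longleftrightarrow>
     S \<noteq> {} \<and> S \<subseteq> fst G \<and>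
     (\<forall>v \<in> fst G - S. nbr_count G S v \<ge> nbr_count G (fst G - S) v + 1)"

text \<open>Meaningful for finite graphs with at least one vertex; the vertex set is then itself a
  global offensive alliance, so the minimum exists.\<close>

definition global_offensive_alliance_number :: "'a sgraph \<Rightarrow> nat" where
  "global_offensive_alliance_number G = Min {card S | S. global_offensive_alliance G S}"

end

theory Submission
  imports Defs "HOL-Algebra.Multiplicative_Group"
begin

text \<open>Write \<open>n\<close> for the number of vertices and \<open>g\<close> for the alliance number. The inequality says
  \<open>g - 1 \<le> (n - g) (g - 1)\<close>, so it can only fail if \<open>n \<le> g\<close> and \<open>g > 1\<close>. If some vertex has a
  neighbour, deleting it from the vertex set leaves a global offensive alliance, so \<open>g < n\<close>. Otherwise
  every \<open>x \<in> Z(R)\<^sup>*\<close> has annihilator \<open>{0, x}\<close>; for distinct \<open>x, y \<in> Z(R)\<^sup>*\<close> the product \<open>x y\<close> would be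
  nonzero and killed by both factors, so \<open>x = x y = y\<close>. Hence \<open>n = 1\<close> and \<open>g = 1\<close>.\<close>

lemma fst_zero_divisor_graph [simp]: "fst (zero_divisor_graph R) = nonzero_zero_divisors R"
  by (simp add: zero_divisor_graph_def)

lemma finite_global_offensive_alliance_cards:
  assumes "finite (fst G)"
  shows "finite {card S | S. global_offensive_alliance G S}"
proof (rule finite_subset)
  show "{card S | S. global_offensive_alliance G S} \<subseteq> card ` Pow (fst G)"
    by (auto simp: global_offensive_alliance_def)
qed (use assms in simp)

lemma global_offensive_alliance_number_le:
  assumes "finite (fst G)" and "global_offensive_alliance G S"
  shows "global_offensive_alliance_number G \<le> card S"
  unfolding global_offensive_alliance_number_def
  using assms(2) finite_global_offensive_alliance_cards[OF assms(1)] by (intro Min_le) auto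

text \<open>The degree condition is vacuous, since no vertex lies outside. This shows that the
  \<open>Min\<close> defining the alliance number ranges over a nonempty set.\<close>

lemma global_offensive_alliance_vertices:
  assumes "fst G \<noteq> {}"
  shows "global_offensive_alliance G (fst G)"
  using assms by (simp add: global_offensive_alliance_def)

lemma global_offensive_alliance_number_pos:
  assumes "finite (fst G)" and "fst G \<noteq> {}"
  shows "global_offensive_alliance_number G > 0"
proof -
  have "global_offensive_alliance_number G \<in> {card S | S. global_offensive_alliance G S}"
    unfolding global_offensive_alliance_number_def
    using finite_global_offensive_alliance_cards[OF assms(1)]
      global_offensive_alliance_vertices[OF assms(2)] by (intro Min_in) auto
  then obtain S where "global_offensive_alliance_number G = card S" "S \<noteq> {}" "S \<subseteq> fst G"
    by (auto simp: global_offensive_alliance_def)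
  with assms(1) show ?thesis
    by (simp add: card_gt_0_iff finite_subset)
qed

text \<open>Only \<open>v\<close> has to be checked: \<open>u\<close> gives it a neighbour inside,
  and its only possible neighbour outside is \<open>v\<close> itself. The type of \<open>G\<close>
  does not exclude a loop, which would be the edge \<open>{v}\<close>; hence the last
  assumption.\<close>

lemma global_offensive_alliance_minus_vertex:
  assumes "finite (fst G)" and "u \<in> fst G" and "u \<noteq> v" and "{u, v} \<in> snd G" and "{v} \<notin> snd G"
  shows "global_offensive_alliance G (fst G - {v})"
proof -
  have "u \<in> {u \<in> fst G - {v}. {u, v} \<in> snd G}"
    using assms by simp
  then have "nbr_count G (fst G - {v}) v > 0"
    unfolding nbr_count_def card_gt_0_iff using assms(1) by auto
  moreover have "nbr_count G (fst G - (fst G - {v})) w = 0" if "w = v" for w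
  proof -
    have "{u \<in> fst G - (fst G - {v}). {u, w} \<in> snd G} = {}"
      using assms(5) that by auto
    then show ?thesis unfolding nbr_count_def by (simp only: card.empty)
  qed
  ultimately show ?thesis
    using assms(2,3) by (auto simp: global_offensive_alliance_def)
qed

context cring
begin

lemma nonzero_zero_divisorsI:
  assumes "x \<in> carrier R" "y \<in> carrier R" "x \<noteq> \<zero>" "y \<noteq> \<zero>" "x \<otimes> y = \<zero>"
  shows "x \<in> nonzero_zero_divisors R"
  using assms by (auto simp: nonzero_zero_divisors_def zero_divisors_def)

lemma nonzero_zero_divisorsE:
  assumes "x \<in> nonzero_zero_divisors R"
  obtains y where "x \<in> carrier R" "y \<in> carrier R" "x \<noteq> \<zero>" "y \<noteq> \<zero>" "x \<otimes> y = \<zero>"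
    "y \<in> nonzero_zero_divisors R"
  using assms m_comm nonzero_zero_divisorsI
  by (auto simp: nonzero_zero_divisors_def zero_divisors_def)

text \<open>A finite integral domain is a field: cancellation makes multiplication by a nonzero
  \<open>x\<close> injective, hence surjective on the finite carrier, so it attains
  \<open>\<one>\<close>.\<close>

lemma nonzero_zero_divisors_nonempty:
  assumes "finite (carrier R)" and "\<one> \<noteq> \<zero>" and "\<not> field R"
  shows "nonzero_zero_divisors R \<noteq> {}"
proof
  assume "nonzero_zero_divisors R = {}"
  then have cancel: "y = \<zero>" if "x \<otimes> y = \<zero>" "x \<noteq> \<zero>" "x \<in> carrier R" "y \<in> carrier R" for x y
    using that nonzero_zero_divisorsI by blast
  have "x \<in> Units R" if x: "x \<in> carrier R" "x \<noteq> \<zero>" for x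
  proof -
    have "inj_on ((\<otimes>) x) (carrier R)"
    proof (rule inj_onI)
      fix y z assume yz: "y \<in> carrier R" "z \<in> carrier R" "x \<otimes> y = x \<otimes> z"
      then have "x \<otimes> (y \<ominus> z) = \<zero>"
        using x by (simp add: a_minus_def r_distr r_minus r_neg)
      then have "y \<ominus> z = \<zero>" using cancel x yz by simp
      then show "y = z" using yz(1,2) by (simp only: r_right_minus_eq)
    qed
    then have "(\<otimes>) x ` carrier R = carrier R"
      using assms(1) x by (intro endo_inj_surj) auto
    then obtain y where "y \<in> carrier R" "x \<otimes> y = \<one>"
      by (metis imageE one_closed)
    then show ?thesis using x m_comm[of x y] by (auto simp: Units_def)
  qed
  moreover have "\<zero> \<notin> Units R"
    using assms(2) by (auto simp: Units_def)
  ultimately have "Units R = carrier R - {\<zero>}"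
    using Units_closed by blast
  with assms(3) show False
    using cring_fieldI by blast
qed

lemma adjacent_zero_divisors_exist:
  assumes x: "x \<in> nonzero_zero_divisors R" and y: "y \<in> nonzero_zero_divisors R" and "x \<noteq> y"
  shows "\<exists>u \<in> nonzero_zero_divisors R. \<exists>v \<in> nonzero_zero_divisors R. u \<noteq> v \<and> u \<otimes> v = \<zero>"
proof (rule ccontr)
  assume "\<not> ?thesis"
  then have eq: "u = v" if "u \<in> nonzero_zero_divisors R" "v \<in> nonzero_zero_divisors R" "u \<otimes> v = \<zero>"
    for u v using that by blast
  have carr: "x \<in> carrier R" "y \<in> carrier R" and nz: "x \<noteq> \<zero>" "y \<noteq> \<zero>"
    using x y by (auto elim: nonzero_zero_divisorsE)
  \<comment> \<open>The nonzero annihilating partner of \<open>z\<close> is itself a vertex, so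
    \<open>eq\<close> identifies it with \<open>z\<close>.\<close>
  have sq: "z \<otimes> z = \<zero>" if "z \<in> nonzero_zero_divisors R" for z
    using that eq by (metis nonzero_zero_divisorsE)
  have xy: "x \<otimes> y \<noteq> \<zero>" using eq x y \<open>x \<noteq> y\<close> by blast
  have x0: "x \<otimes> (x \<otimes> y) = \<zero>"
    using carr sq[OF x] by (simp flip: m_assoc)
  have y0: "y \<otimes> (x \<otimes> y) = \<zero>"
    using carr sq[OF y] by (simp add: m_lcomm)
  \<comment> \<open>Being nonzero and killed by \<open>x\<close>, the product is a vertex, so
    \<open>eq\<close> can compare it with each factor.\<close>
  have "x \<otimes> y \<in> nonzero_zero_divisors R"
    using carr nz xy x0 m_comm by (intro nonzero_zero_divisorsI[of _ x]) auto
  then have "x = x \<otimes> y" "y = x \<otimes> y"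
    using eq x y x0 y0 by blast+
  with \<open>x \<noteq> y\<close> show False by simp
qed

end

text \<open>A maximal ideal is proper, whereas in the zero ring every ideal contains
  \<open>\<zero>\<close> and so is the whole ring.\<close>

lemma one_not_zero_if_maximalideal:
  assumes "cring R" and "maximalideal M R"
  shows "\<one>\<^bsub>R\<^esub> \<noteq> \<zero>\<^bsub>R\<^esub>"
proof
  interpret cring R by fact
  interpret M: maximalideal M R by fact
  assume "\<one>\<^bsub>R\<^esub> = \<zero>\<^bsub>R\<^esub>"
  then have "carrier R = {\<zero>\<^bsub>R\<^esub>}" by (rule one_zeroD)
  then show False
    using M.I_notcarr M.a_subset M.zero_closed by auto
qed

theorem theorem2p2:
  fixes R :: "('a, 'b) ring_scheme"
  assumes "local_ring R"
    and "finite (carrier R)"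
    and "\<not> field R"
  shows "int (global_offensive_alliance_number (zero_divisor_graph R)) \<le>
    (int (card (nonzero_zero_divisors R)) -
       int (global_offensive_alliance_number (zero_divisor_graph R))) *
    (int (global_offensive_alliance_number (zero_divisor_graph R)) - 1) + 1"
proof -
  let ?G = "zero_divisor_graph R"
  let ?V = "nonzero_zero_divisors R"
  let ?g = "global_offensive_alliance_number ?G"
  interpret cring R using assms(1) by (simp add: local_ring_def)
  obtain M where "maximalideal M R" using assms(1) by (auto simp: local_ring_def)
  then have "\<one>\<^bsub>R\<^esub> \<noteq> \<zero>\<^bsub>R\<^esub>" using one_not_zero_if_maximalideal is_cring by blast
  then have ne: "?V \<noteq> {}" using assms(2,3) by (intro nonzero_zero_divisors_nonempty)
  have fin: "finite ?V"
    using assms(2) by (rule rev_finite_subset)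
      (auto simp: nonzero_zero_divisors_def zero_divisors_def)
  have le: "?g \<le> card ?V"
    using global_offensive_alliance_number_le[of ?G ?V] global_offensive_alliance_vertices[of ?G]
      fin ne by simp
  show ?thesis
  proof (cases "?g \<le> 1")
    \<comment> \<open>Here positivity forces \<open>?g = 1\<close>; the factor \<open>?g - 1\<close>
      vanishes and both sides equal 1.\<close>
    case True
    have "?g > 0"
      using global_offensive_alliance_number_pos[of ?G] fin ne by simp
    with True have "?g = 1" by linarith
    then show ?thesis by simp
  next
    case False
    \<comment> \<open>Now 1 < \<open>?g\<close> \<le> \<open>card ?V\<close>, so there are two
      distinct vertices.\<close>
    with le have "\<not> is_singleton ?V" by (auto simp: is_singleton_altdef)
    then obtain x y where "x \<in> ?V" "y \<in> ?V" "x \<noteq> y"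
      using ne by (metis is_singletonI')
    then obtain u v where uv: "u \<in> ?V" "v \<in> ?V" "u \<noteq> v" "u \<otimes>\<^bsub>R\<^esub> v = \<zero>\<^bsub>R\<^esub>"
      using adjacent_zero_divisors_exist by blast
    then have "{u, v} \<in> snd ?G" "{v} \<notin> snd ?G"
      by (auto simp: zero_divisor_graph_def)
    then have "global_offensive_alliance ?G (?V - {v})"
      using global_offensive_alliance_minus_vertex[of ?G u v] fin uv by simp
    then have "?g \<le> card (?V - {v})"
      using global_offensive_alliance_number_le[of ?G] fin by simp
    then have "?g < card ?V"
      using fin uv(2) by (metis card_Diff1_less order.strict_trans1)
    \<comment> \<open>The strict bound makes the integer \<open>card ?V - ?g\<close> at least 1, and
      \<open>?g - 1\<close> is nonnegative.\<close>
    then have "(int ?g - 1) * 1 \<le> (int ?g - 1) * (int (card ?V) - int ?g)"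
      using False by (intro mult_left_mono) auto
    then show ?thesis by (simp add: mult.commute)
  qed
qed

end
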